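(* Let $K$ be a field of characteristic zero (not necessarily algebraically closed) with algebraic closure $\overline{K}$, let $f=x^d+a_{d-1}x^{d-1}+\cdots+a_0\in K[x]$ be a monic polynomial of degree $d\ge1$, and let $f(x)=(x-\nu)^s g\big((x-\nu)^n\big)$ be its eigenform (as an element of $\overline{K}[x]$). Then $\nu\in K$ and $g(x)\in K[x]$. Moreover: 1. $G_f(K)=G_f(\overline{K})\cap\mathrm{Aut}_K(K[x])=\{\sigma\in G_f(\overline{K})\mid\sigma(x)\in K[x]\}$. 2. If $f(x)=(x-\nu)^d$ has only a single root $\nu$, then $G_f(K)=\{\sigma_{\lambda,(1-\lambda)\nu}\mid\lambda\in K^\times\}\simeq K^\times$ via $\sigma_{\lambda,(1-\lambda)\nu}\mapsto\lambda$, where $\sigma_{\lambda,(1-\lambda)\nu}(x)=\lambda x+(1-\lambda)\nu$. 3. Suppose that $f$ has at least two distinct roots in $\overline{K}$. Then: (a) $G_f(K)\ne\{e\}$ if and only if $n>1$ and $\lambda_m:=e^{2\pi i/m}\in K$ for some natural number $m\ge2$ such that $m\mid n$. (b) If $n>1$ and $n':=\max\{m\mid m\mid n,\ \lambda_m\in K\}\ge2$, then $G_f(K)=\langle\sigma_{\lambda_{n'},(1-\lambda_{n'})\nu}\rangle=\{\sigma_{\lambda_{n'},(1-\lambda_{n'})\nu}^j\mid 0\le j\le n'-1\}$ is the cyclic group of order $n'$, where $\lambda_{n'}=e^{2\pi i/n'}$ and $\sigma_{\lambda_{n'},(1-\lambda_{n'})\nu}(x)=\lambda_{n'}x+(1-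\lambda_{n'})\nu$.
   Context: $K^\times=K\setminus\{0\}$. For a field $F$ ($F=K$ or $F=\overline{K}$), $\lambda\in F^\times$ and $\mu\in F$, $\sigma_{\lambda,\mu}\in\mathrm{Aut}_F(F[x])$ is the $F$-automorphism with $\sigma_{\lambda,\mu}(x)=\lambda x+\mu$; these are all the elements of $\mathrm{Aut}_F(F[x])$. The group $\mathrm{Aut}_K(K[x])$ is regarded as a subgroup of $\mathrm{Aut}_{\overline{K}}(\overline{K}[x])$ by $\overline{K}$-linear extension. The eigengroup of $f$ over $F$ is $G_f(F)=\{\sigma\in\mathrm{Aut}_F(F[x])\mid\sigma(f)=cf\text{ for some }c\in F\}$. The symbol $\lambda_m=e^{2\pi i/m}$ denotes a fixed primitive $m$-th root of unity in $\overline{K}$. Exponent: for a monic polynomial $h(x)=\sum_i a_ix^i$, $\gcd(h(x)):=\gcd\{i\ge1\mid a_i\ne0\}$ (the leading coefficient is included; the gcd of the empty set, occurring when $h=1$, is $0$). Eigenform: for a monic polynomial $f(x)=x^d+a_{d-1}x^{d-1}+\cdots+a_0\in\overline{K}[x]$ of degree $d\ge1$, the eigenform is the unique presentation $f(x)=(x-\nu)^s g\big((x-\nu)^n\big)$ where $\nu:=-\frac{a_{d-1}}{d}$; $s\ge0$ is the multiplicity of $\nu$ as a root of $f$ ($s=0$ if $\nu$ is not a root); $n:=\gcd\big(f(x+\nu)/x^s\big)$; and $g(x)\in\overline{K}[x]$ is a monic polynomial such that $d=s+n\deg(g(x))$. If $f(x)=(x-\nu')^d$ has a single root then, by convention, $\nu=\nu'$,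 $s=d$, $n=0$, $g=1$. *)

theory Defs
  imports
    "HOL-Algebra.Algebra"
    "HOL-Algebra.Algebraic_Closure_Type"
begin

section \<open>Automorphisms of \<open>F[x]\<close> and eigengroups\<close>

definition poly_aut :: "('a :: field poly \<Rightarrow> 'a poly) set" where
  "poly_aut = {\<sigma> \<in> ring_iso ring_of_type_algebra ring_of_type_algebra. \<forall>c. \<sigma> [:c:] = [:c:]}"

definition comp_group :: "('b \<Rightarrow> 'b) set \<Rightarrow> ('b \<Rightarrow> 'b) monoid" where
  "comp_group S = \<lparr>carrier = S, monoid.mult = (\<circ>), one = id\<rparr>"

definition subst_aut :: "'a :: field \<Rightarrow> 'a \<Rightarrow> 'a poly \<Rightarrow> 'a poly" where
  "subst_aut l u p = pcompose p [:u, l:]"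

definition eigengroup :: "'a :: field poly \<Rightarrow> ('a poly \<Rightarrow> 'a poly) set" where
  "eigengroup f = {\<sigma> \<in> poly_aut. \<exists>c. \<sigma> f = Polynomial.smult c f}"

abbreviation mult_group :: "'a :: field itself \<Rightarrow> 'a monoid" where
  "mult_group (_ :: 'a itself) \<equiv> mult_of (ring_of_type_algebra :: 'a ring)"

abbreviation poly_to_ac :: "'a :: field poly \<Rightarrow> 'a alg_closure poly" where
  "poly_to_ac \<equiv> map_poly to_ac"

text \<open>
  The extension of a \<open>K\<close>-linear map \<open>\<sigma>\<close> on \<open>K[x]\<close> to a linear map on polynomials over the
  algebraic closure, written out on the basis of monomials. On \<^const>\<open>poly_aut\<close> it is an
  injective group homomorphism (see \<open>poly_ext_hom\<close> and \<open>inj_poly_ext\<close> below).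
\<close>
definition poly_ext ::
  "('a :: field poly \<Rightarrow> 'a poly) \<Rightarrow> 'a alg_closure poly \<Rightarrow> 'a alg_closure poly" where
  "poly_ext \<sigma> p =
     (\<Sum>i\<le>Polynomial.degree p.
        Polynomial.smult (Polynomial.coeff p i) (poly_to_ac (\<sigma> (Polynomial.monom 1 i))))"

section \<open>Eigenforms\<close>

definition poly_exponent :: "'a :: zero poly \<Rightarrow> nat" where
  "poly_exponent h = Gcd {i. i \<ge> 1 \<and> Polynomial.coeff h i \<noteq> 0}"

text \<open>
  The quotient by \<open>x^s\<close> in the third line is exact, \<open>s\<close> being the multiplicity of \<open>\<nu>\<close>.
  The last line is the convention for polynomials \<open>f = (x - a)^d\<close> with a single root: there
  \<open>\<nu> = a\<close>, \<open>s = d\<close> and \<open>n = 0\<close> follow from the preceding lines, but \<open>g\<close> is not determined by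
  them. Existence and uniqueness are shown in \<open>is_eigenform_ex1\<close> below.
\<close>
definition is_eigenform ::
  "'a :: field_char_0 poly \<Rightarrow> 'a \<Rightarrow> nat \<Rightarrow> nat \<Rightarrow> 'a poly \<Rightarrow> bool" where
  "is_eigenform f \<nu> s n g \<longleftrightarrow>
     \<nu> = - (Polynomial.coeff f (Polynomial.degree f - 1) / of_nat (Polynomial.degree f)) \<and>
     s = Polynomial.order \<nu> f \<and>
     n = poly_exponent (pcompose f [:\<nu>, 1:] div Polynomial.monom 1 s) \<and>
     Polynomial.lead_coeff g = 1 \<and>
     Polynomial.degree f = s + n * Polynomial.degree g \<and>
     f = [:- \<nu>, 1:] ^ s * pcompose g ([:- \<nu>, 1:] ^ n) \<and>
     ((\<exists>a. f = [:- a, 1:] ^ Polynomial.degree f) \<longrightarrow> g = 1)"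

definition is_primitive_root_of_unity :: "nat \<Rightarrow> 'a :: field \<Rightarrow> bool" where
  "is_primitive_root_of_unity m z \<longleftrightarrow> m > 0 \<and> z ^ m = 1 \<and> (\<forall>k. 0 < k \<and> k < m \<longrightarrow> z ^ k \<noteq> 1)"

section \<open>Well-definedness\<close>

lemma poly_autD:
  assumes "\<sigma> \<in> poly_aut"
  shows "\<sigma> (p + q) = \<sigma> p + \<sigma> q" "\<sigma> (p * q) = \<sigma> p * \<sigma> q" "\<sigma> 1 = 1" "\<sigma> [:c:] = [:c:]" "bij \<sigma>"
  using assms by (auto simp: poly_aut_def ring_iso_def ring_hom_def ring_of_type_algebra_def)

lemma poly_autI:
  assumes "\<And>p q. \<sigma> (p + q) = \<sigma> p + \<sigma> q" "\<And>p q. \<sigma> (p * q) = \<sigma> p * \<sigma> q"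
    "\<And>c. \<sigma> [:c:] = [:c:]" "bij \<sigma>"
  shows "\<sigma> \<in> poly_aut"
  using assms assms(3)[of 1]
  by (auto simp: poly_aut_def ring_iso_def ring_hom_def ring_of_type_algebra_def one_pCons)

lemma poly_aut_pcompose:
  assumes "\<sigma> \<in> poly_aut"
  shows "\<sigma> p = pcompose p (\<sigma> [:0, 1:])"
proof (induction p)
  case 0
  then show ?case using poly_autD(4)[OF assms, of 0] by simp
next
  case (pCons a p)
  have "pCons a p = [:a:] + [:0, 1:] * p" by simp
  then have "\<sigma> (pCons a p) = [:a:] + \<sigma> [:0, 1:] * \<sigma> p"
    using poly_autD[OF assms] by metis
  then show ?case using pCons.IH by (simp add: pcompose_pCons)
qed

lemma comp_poly_aut: "\<sigma> \<in> poly_aut \<Longrightarrow> \<tau> \<in> poly_aut \<Longrightarrow> \<sigma> \<circ> \<tau> \<in> poly_aut"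
  by (intro poly_autI) (auto simp: poly_autD intro: bij_comp dest: poly_autD(5))

lemma id_poly_aut: "id \<in> poly_aut"
  by (intro poly_autI) auto

lemma inv_poly_aut:
  assumes "\<sigma> \<in> poly_aut"
  shows "inv_into UNIV \<sigma> \<in> poly_aut"
proof (intro poly_autI)
  note D = poly_autD[OF assms]
  have s: "\<sigma> (inv_into UNIV \<sigma> x) = x" for x using D(5) by (simp add: bij_is_surj surj_f_inv_f)
  have i: "inv_into UNIV \<sigma> (\<sigma> x) = x" for x using D(5) by (simp add: bij_is_inj)
  show "inv_into UNIV \<sigma> (p + q) = inv_into UNIV \<sigma> p + inv_into UNIV \<sigma> q" for p q using i D(1) s by metis
  show "inv_into UNIV \<sigma> (p * q) = inv_into UNIV \<sigma> p * inv_into UNIV \<sigma> q" for p q using i D(2) s by metis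
  show "inv_into UNIV \<sigma> [:c:] = [:c:]" for c using i D(4) by metis
  show "bij (inv_into UNIV \<sigma>)" using D(5) by (rule bij_imp_bij_inv)
qed

lemma group_poly_aut: "group (comp_group poly_aut)"
proof (rule groupI)
  fix \<sigma> :: "'a poly \<Rightarrow> 'a poly" assume "\<sigma> \<in> carrier (comp_group poly_aut)"
  then have s: "\<sigma> \<in> poly_aut" by (simp add: comp_group_def)
  then have "inv_into UNIV \<sigma> \<circ> \<sigma> = id" using poly_autD(5) bij_is_inj inv_o_cancel by blast
  with inv_poly_aut[OF s]
  show "\<exists>\<tau>\<in>carrier (comp_group poly_aut).
          \<tau> \<otimes>\<^bsub>comp_group poly_aut\<^esub> \<sigma> = \<one>\<^bsub>comp_group poly_aut\<^esub>"
    by (auto simp: comp_group_def)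
qed (auto simp: comp_group_def comp_poly_aut id_poly_aut[unfolded id_def] o_assoc id_poly_aut)

lemma subgroup_eigengroup: "subgroup (eigengroup f) (comp_group poly_aut)"
proof (rule group.subgroupI[OF group_poly_aut])
  have sm: "\<sigma> (Polynomial.smult c p) = Polynomial.smult c (\<sigma> p)"
    if "\<sigma> \<in> poly_aut" for \<sigma> :: "'a poly \<Rightarrow> 'a poly" and c p
    using poly_autD(2,4)[OF that] by (metis mult_pCons_left mult_zero_left pCons_0_0 add.right_neutral)
  show "eigengroup f \<subseteq> carrier (comp_group poly_aut)"
    by (auto simp: eigengroup_def comp_group_def)
  show "eigengroup f \<noteq> {}"
    using id_poly_aut by (auto simp: eigengroup_def intro!: exI[of _ id] exI[of _ 1])
  fix \<sigma> assume "\<sigma> \<in> eigengroup f"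
  then obtain c where s: "\<sigma> \<in> poly_aut" and c: "\<sigma> f = Polynomial.smult c f"
    by (auto simp: eigengroup_def)
  have inj: "inj \<sigma>" and surj: "surj \<sigma>" using poly_autD(5)[OF s] by (auto simp: bij_def)
  have "inv_into UNIV \<sigma> \<circ> \<sigma> = id" using inj by simp
  then have inv: "inv\<^bsub>comp_group poly_aut\<^esub> \<sigma> = inv_into UNIV \<sigma>"
    using group.inv_equality[OF group_poly_aut, of "inv_into UNIV \<sigma>" \<sigma>] inv_poly_aut[OF s] s
    by (simp add: comp_group_def)
  have "\<exists>c. inv_into UNIV \<sigma> f = Polynomial.smult c f"
  proof (cases "f = 0")
    case True
    have "\<sigma> 0 = 0" using poly_autD(4)[OF s, of 0] by simp
    then show ?thesis using True inj by (metis inv_f_f smult_0_right)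
  next
    case False
    have "\<sigma> 0 = 0" using poly_autD(4)[OF s, of 0] by simp
    then have "c \<noteq> 0" using c False inj by (metis injD smult_0_left)
    then have "\<sigma> (Polynomial.smult (inverse c) f) = f" using sm[OF s] c by simp
    then have "inv_into UNIV \<sigma> f = Polynomial.smult (inverse c) f" using inj by (metis inv_f_f)
    then show ?thesis by blast
  qed
  then show "inv\<^bsub>comp_group poly_aut\<^esub> \<sigma> \<in> eigengroup f"
    using inv inv_poly_aut[OF s] by (simp add: eigengroup_def)
  fix \<tau> assume "\<tau> \<in> eigengroup f"
  then show "\<sigma> \<otimes>\<^bsub>comp_group poly_aut\<^esub> \<tau> \<in> eigengroup f"
    using s c sm[OF s] by (auto simp: eigengroup_def comp_group_def comp_poly_aut)
qed

lemma poly_to_ac_add: "poly_to_ac (p + q) = poly_to_ac p + poly_to_ac q"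
  by (intro poly_eqI) (simp add: coeff_map_poly)

lemma poly_to_ac_mult: "poly_to_ac (p * q) = poly_to_ac p * poly_to_ac q"
  by (intro poly_eqI) (simp add: coeff_map_poly coeff_mult to_ac_sum)

lemma poly_to_ac_power: "poly_to_ac (p ^ n) = poly_to_ac p ^ n"
  by (induction n) (simp_all add: poly_to_ac_mult)

lemma poly_to_ac_pcompose: "poly_to_ac (pcompose p q) = pcompose (poly_to_ac p) (poly_to_ac q)"
  by (induction p) (simp_all add: pcompose_pCons poly_to_ac_add poly_to_ac_mult map_poly_pCons)

lemma inj_poly_to_ac: "inj poly_to_ac"
  by (intro injI poly_eqI) (metis coeff_map_poly to_ac_0 to_ac_eq_iff)

lemma pcompose_monom: "pcompose (Polynomial.monom c i) r = Polynomial.smult c (r ^ i)"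
  for r :: "'a :: field poly"
  by (induction i) (simp_all add: monom_0 monom_Suc pcompose_pCons mult_ac)

lemma pcompose_as_sum:
  "pcompose p r = (\<Sum>i\<le>Polynomial.degree p. Polynomial.smult (Polynomial.coeff p i) (r ^ i))"
  for r :: "'a :: field poly"
proof -
  have "pcompose p r =
      pcompose (\<Sum>i\<le>Polynomial.degree p. Polynomial.monom (Polynomial.coeff p i) i) r"
    by (simp add: poly_as_sum_of_monoms)
  then show ?thesis by (simp add: pcompose_sum pcompose_monom)
qed

lemma poly_ext_pcompose:
  assumes "\<sigma> \<in> poly_aut"
  shows "poly_ext \<sigma> p = pcompose p (poly_to_ac (\<sigma> [:0, 1:]))"
proof -
  have "poly_ext \<sigma> p =
      (\<Sum>i\<le>Polynomial.degree p.
         Polynomial.smult (Polynomial.coeff p i) (poly_to_ac (\<sigma> [:0, 1:]) ^ i))"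
    unfolding poly_ext_def
    by (subst poly_aut_pcompose[OF assms]) (simp add: pcompose_monom poly_to_ac_power)
  also have "\<dots> = pcompose p (poly_to_ac (\<sigma> [:0, 1:]))"
    by (simp add: pcompose_as_sum)
  finally show ?thesis .
qed

lemma poly_ext_poly_to_ac: "\<sigma> \<in> poly_aut \<Longrightarrow> poly_ext \<sigma> (poly_to_ac p) = poly_to_ac (\<sigma> p)"
  by (metis poly_ext_pcompose poly_aut_pcompose poly_to_ac_pcompose)

lemma poly_ext_comp:
  assumes "\<sigma> \<in> poly_aut" "\<tau> \<in> poly_aut"
  shows "poly_ext (\<sigma> \<circ> \<tau>) = poly_ext \<sigma> \<circ> poly_ext \<tau>"
proof
  fix p
  have "poly_ext \<sigma> (poly_ext \<tau> p) = pcompose p (poly_ext \<sigma> (poly_to_ac (\<tau> [:0, 1:])))"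
    using assms by (simp add: poly_ext_pcompose pcompose_assoc)
  also have "\<dots> = poly_ext (\<sigma> \<circ> \<tau>) p"
    unfolding poly_ext_poly_to_ac[OF assms(1)] poly_ext_pcompose[OF comp_poly_aut[OF assms]] by simp
  finally show "poly_ext (\<sigma> \<circ> \<tau>) p = (poly_ext \<sigma> \<circ> poly_ext \<tau>) p" by simp
qed

lemma poly_ext_id: "poly_ext id = id"
  by (rule ext) (simp add: poly_ext_pcompose id_poly_aut map_poly_pCons)

lemma poly_ext_poly_aut:
  assumes "\<sigma> \<in> poly_aut"
  shows "poly_ext \<sigma> \<in> poly_aut"
proof (intro poly_autI)
  note b = poly_autD(5)[OF assms] and i = inv_poly_aut[OF assms]
  have "inv_into UNIV \<sigma> \<circ> \<sigma> = id" "\<sigma> \<circ> inv_into UNIV \<sigma> = id"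
    using b by (auto simp: bij_def surj_iff)
  then have "poly_ext (inv_into UNIV \<sigma>) \<circ> poly_ext \<sigma> = id" "poly_ext \<sigma> \<circ> poly_ext (inv_into UNIV \<sigma>) = id"
    using assms i by (simp_all flip: poly_ext_comp add: poly_ext_id)
  then show "bij (poly_ext \<sigma>)" by (metis o_bij)
qed (simp_all add: poly_ext_pcompose[OF assms] pcompose_add pcompose_mult)

lemma poly_ext_hom: "poly_ext \<in> hom (comp_group poly_aut) (comp_group poly_aut)"
  by (auto simp: hom_def comp_group_def poly_ext_poly_aut poly_ext_comp)

lemma inj_poly_ext: "inj_on poly_ext poly_aut"
proof (rule inj_onI, rule ext)
  fix \<sigma> \<tau> :: "'a poly \<Rightarrow> 'a poly" and p
  assume "\<sigma> \<in> poly_aut" "\<tau> \<in> poly_aut" "poly_ext \<sigma> = poly_ext \<tau>"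
  then have "poly_to_ac (\<sigma> p) = poly_to_ac (\<tau> p)" by (metis poly_ext_poly_to_ac)
  then show "\<sigma> p = \<tau> p" using inj_poly_to_ac by (metis injD)
qed

lemma is_eigenform_ex1:
  fixes f :: "'a :: field_char_0 poly"
  assumes monic: "Polynomial.lead_coeff f = 1" and deg: "Polynomial.degree f \<ge> 1"
  shows "\<exists>!(\<nu>, s, n, g). is_eigenform f \<nu> s n g"
proof -
  let ?d = "Polynomial.degree f"
  define \<nu> where "\<nu> = - (Polynomial.coeff f (?d - 1) / of_nat ?d)"
  define s where "s = Polynomial.order \<nu> f"
  define h where "h = pcompose f [:\<nu>, 1:] div Polynomial.monom 1 s"
  define n where "n = poly_exponent h"
  have f0: "f \<noteq> 0" using deg by auto
  obtain q where q: "f = [:- \<nu>, 1:] ^ s * q"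
    using order_1[of \<nu> f] by (auto simp: s_def dvd_def)
  have c1: "pcompose [:- \<nu>, 1:] [:\<nu>, 1:] = [:0, 1:]"
    and c2: "pcompose [:\<nu>, 1:] [:- \<nu>, 1:] = [:0, 1:]"
    by (simp_all add: pcompose_pCons)
  have pw: "pcompose (p ^ k) r = pcompose p r ^ k" for p r :: "'a poly" and k
    by (induction k) (simp_all add: pcompose_mult pcompose_1)
  have hq: "h = pcompose q [:\<nu>, 1:]"
    by (subst h_def, subst q)
      (simp add: pcompose_mult pw c1 monom_altdef)
  have qh: "q = pcompose h [:- \<nu>, 1:]"
    by (simp add: hq pcompose_assoc[symmetric] c2)
  have fh: "f = [:- \<nu>, 1:] ^ s * pcompose h [:- \<nu>, 1:]" using q qh by simp
  have lp: "Polynomial.lead_coeff ([:- \<nu>, 1:] ^ s) = 1" by (simp add: lead_coeff_power)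
  have hm: "Polynomial.lead_coeff h = 1"
  proof -
    have "Polynomial.lead_coeff q = 1"
      using monic q lp by (metis lead_coeff_mult mult_1)
    then show ?thesis unfolding hq by (subst lead_coeff_comp) simp_all
  qed
  have h0: "h \<noteq> 0" using hm by auto
  have dh: "?d = s + Polynomial.degree h"
  proof -
    have "q \<noteq> 0" using f0 q by auto
    then have "?d = s + Polynomial.degree q"
      by (subst q) (simp add: degree_mult_eq degree_power_eq)
    then show ?thesis by (simp add: hq degree_pcompose)
  qed
  have h1: "h = 1" if "Polynomial.degree h = 0"
    using that hm by (elim degree_eq_zeroE) (simp add: one_pCons)
  have n0: "h = 1" if "n = 0"
  proof -
    have "Polynomial.degree h = 0"
    proof (rule ccontr)
      assume "Polynomial.degree h \<noteq> 0"
      then have "Polynomial.degree h \<in> {i. i \<ge> 1 \<and> Polynomial.coeff h i \<noteq> 0}" using hm by simp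
      then have "n dvd Polynomial.degree h"
        unfolding n_def poly_exponent_def by (rule Gcd_dvd)
      then show False using that \<open>Polynomial.degree h \<noteq> 0\<close> by simp
    qed
    then show ?thesis by (rule h1)
  qed
  have single: "h = 1" if f_a: "f = [:- a, 1:] ^ ?d" for a
  proof -
    have "Polynomial.coeff f (?d - 1) = - (of_nat ?d * a)"
      by (subst f_a, subst coeff_linear_poly_power)
        (use deg binomial_symmetric[of "?d - 1" ?d] in simp_all)
    then have "\<nu> = a" using deg by (simp add: \<nu>_def)
    then have "s = ?d" using f_a by (metis s_def order_power_n_n)
    then have "Polynomial.degree h = 0" using dh by simp
    then show ?thesis by (rule h1)
  qed
  have ex: "\<exists>g. is_eigenform f \<nu> s n g"
  proof (cases "n = 0")
    case True
    then have h: "h = 1" by (rule n0)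
    have "is_eigenform f \<nu> s n 1"
      unfolding is_eigenform_def
    proof (intro conjI impI)
      show "?d = s + n * Polynomial.degree (1 :: 'a poly)" using dh h by simp
      show "f = [:- \<nu>, 1:] ^ s * pcompose 1 ([:- \<nu>, 1:] ^ n)"
        using fh unfolding h pcompose_1 .
    qed (rule \<nu>_def s_def n_def[unfolded h_def] lead_coeff_1 refl)+
    then show ?thesis ..
  next
    case False
    define g where
      "g = (\<Sum>j\<le>Polynomial.degree h. Polynomial.monom (Polynomial.coeff h j) (j div n))"
    have "pcompose g ([:- \<nu>, 1:] ^ n) =
        (\<Sum>j\<le>Polynomial.degree h.
           Polynomial.smult (Polynomial.coeff h j) ([:- \<nu>, 1:] ^ (n * (j div n))))"
      by (simp add: g_def pcompose_sum pcompose_monom power_mult)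
    also have "\<dots> = (\<Sum>j\<le>Polynomial.degree h. Polynomial.smult (Polynomial.coeff h j) ([:- \<nu>, 1:] ^ j))"
    proof (rule sum.cong[OF refl])
      fix j
      have "n * (j div n) = j" if "Polynomial.coeff h j \<noteq> 0"
      proof (cases "j = 0")
        case False
        then have "n dvd j" unfolding n_def poly_exponent_def using that by (intro Gcd_dvd) auto
        then show ?thesis by simp
      qed simp
      then show "Polynomial.smult (Polynomial.coeff h j) ([:- \<nu>, 1:] ^ (n * (j div n))) =
          Polynomial.smult (Polynomial.coeff h j) ([:- \<nu>, 1:] ^ j)"
        by (cases "Polynomial.coeff h j = 0") auto
    qed
    also have "\<dots> = pcompose h [:- \<nu>, 1:]"
      by (simp add: pcompose_as_sum)
    finally have gh: "pcompose g ([:- \<nu>, 1:] ^ n) = pcompose h [:- \<nu>, 1:]" .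
    have dpn: "Polynomial.degree ([:- \<nu>, 1:] ^ n) = n" by (simp add: degree_power_eq)
    have "Polynomial.lead_coeff ([:- \<nu>, 1:] ^ n) = 1" by (subst lead_coeff_power) simp
    then have lpn: "Polynomial.coeff ([:- \<nu>, 1:] ^ n) n = 1" by (simp add: dpn)
    have "Polynomial.degree g * n = Polynomial.degree h"
      using arg_cong[OF gh, of Polynomial.degree] by (simp add: degree_pcompose dpn)
    moreover have "Polynomial.lead_coeff g = 1"
    proof -
      have "Polynomial.lead_coeff (pcompose g ([:- \<nu>, 1:] ^ n)) =
          Polynomial.lead_coeff (pcompose h [:- \<nu>, 1:])" using gh by simp
      then show ?thesis
        using False hm by (subst (asm) (1 2) lead_coeff_comp) (simp_all add: dpn lpn)
    qed
    moreover have "\<not> (\<exists>a. f = [:- a, 1:] ^ ?d)"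
      using single False by (auto simp: n_def poly_exponent_def one_pCons coeff_pCons split: nat.splits)
    ultimately have g: "Polynomial.degree g * n = Polynomial.degree h"
      "Polynomial.lead_coeff g = 1" "\<not> (\<exists>a. f = [:- a, 1:] ^ ?d)" by blast+
    have "is_eigenform f \<nu> s n g"
      unfolding is_eigenform_def
    proof (intro conjI)
      show "?d = s + n * Polynomial.degree g" using dh g(1) by (simp add: mult.commute)
      show "f = [:- \<nu>, 1:] ^ s * pcompose g ([:- \<nu>, 1:] ^ n)" using fh unfolding gh .
      show "(\<exists>a. f = [:- a, 1:] ^ ?d) \<longrightarrow> g = 1" using g(3) by blast
    qed (fact \<nu>_def s_def n_def[unfolded h_def] g(2))+
    then show ?thesis by blast
  qed
  have uniq: "\<nu>' = \<nu> \<and> s' = s \<and> n' = n" if "is_eigenform f \<nu>' s' n' g" for \<nu>' s' n' g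
    using that unfolding is_eigenform_def \<nu>_def s_def n_def h_def by blast
  have uniq_g: "g = g'" if g: "is_eigenform f \<nu> s n g" and g': "is_eigenform f \<nu> s n g'" for g g'
  proof (cases "n = 0")
    case True
    then have h: "h = 1" by (rule n0)
    then have "s = ?d" using dh by simp
    moreover have "f = [:- \<nu>, 1:] ^ s" using fh unfolding h pcompose_1 mult_1_right .
    ultimately have "\<exists>a. f = [:- a, 1:] ^ ?d" by metis
    then have "g = 1" "g' = 1" using g g' unfolding is_eigenform_def by blast+
    then show ?thesis by simp
  next
    case False
    have "f = [:- \<nu>, 1:] ^ s * pcompose g ([:- \<nu>, 1:] ^ n)"
      "f = [:- \<nu>, 1:] ^ s * pcompose g' ([:- \<nu>, 1:] ^ n)"
      using g g' unfolding is_eigenform_def by blast+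
    then have "[:- \<nu>, 1:] ^ s * pcompose g ([:- \<nu>, 1:] ^ n) =
        [:- \<nu>, 1:] ^ s * pcompose g' ([:- \<nu>, 1:] ^ n)" by (rule trans[OF sym])
    then have "pcompose (g - g') ([:- \<nu>, 1:] ^ n) = 0" by (simp add: pcompose_diff)
    moreover have "Polynomial.degree ([:- \<nu>, 1:] ^ n) > 0" using False by (simp add: degree_power_eq)
    ultimately show ?thesis using pcompose_eq_0 by (metis eq_iff_diff_eq_0)
  qed
  from ex obtain g where g: "is_eigenform f \<nu> s n g" ..
  show ?thesis
  proof (rule ex1I[of _ "(\<nu>, s, n, g)"])
    show "case (\<nu>, s, n, g) of (\<nu>, s, n, g) \<Rightarrow> is_eigenform f \<nu> s n g" unfolding prod.case by (fact g)
    fix x assume x: "case x of (\<nu>, s, n, g) \<Rightarrow> is_eigenform f \<nu> s n g"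
    obtain \<nu>' s' n' g' where x_eq: "x = (\<nu>', s', n', g')" by (cases x)
    have e: "is_eigenform f \<nu>' s' n' g'" using x unfolding x_eq prod.case .
    note u = uniq[OF e]
    then have "is_eigenform f \<nu> s n g'" using e by metis
    then have "g' = g" using g by (rule uniq_g)
    then show "x = (\<nu>, s, n, g)" unfolding x_eq using u by blast
  qed
qed

end

theory Submission
  imports Defs
begin

text \<open>
  Comparing the two leading coefficients of \<open>f(lx + u) = c f(x)\<close> forces \<open>u = (1 - l)\<nu>\<close>, so after
  translating \<open>\<nu>\<close> to the origin only the scalings \<open>x \<mapsto> lx\<close> are left. They multiply the coefficient
  of \<open>x^i\<close> by \<open>l^i\<close>; since the lowest coefficient of \<open>f(x + \<nu>)\<close> sits at \<open>x^s\<close>, the eigenvalue is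
  \<open>l^s\<close> and the condition on \<open>l\<close> becomes \<open>l^n = 1\<close>. Hence \<open>G_f(F)\<close> is the group of \<open>n\<close>-th roots of
  unity in \<open>F\<close>, and is all of \<open>F^*\<close> if \<open>n = 0\<close>. The eigenform is compatible with the extension from
  \<open>K\<close> to its closure by uniqueness.
\<close>

section \<open>Roots of unity\<close>

text \<open>Division with remainder: \<open>z ^ k\<close> depends only on \<open>k mod m\<close>,
  and by minimality of \<open>m\<close> no positive remainder gives the power 1.\<close>

lemma primitive_root_power_eq_1_iff:
  fixes z :: "'a :: field"
  assumes "is_primitive_root_of_unity m z"
  shows "z ^ k = 1 \<longleftrightarrow> m dvd k"
proof -
  have m: "m > 0" "z ^ m = 1" and least: "\<And>j. 0 < j \<Longrightarrow> j < m \<Longrightarrow> z ^ j \<noteq> 1"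
    using assms by (auto simp: is_primitive_root_of_unity_def)
  have "z ^ k = z ^ (m * (k div m) + k mod m)" by simp
  also have "\<dots> = z ^ (k mod m)" unfolding power_add power_mult m(2) by simp
  finally have eq: "z ^ k = z ^ (k mod m)" .
  have "z ^ (k mod m) = 1 \<longleftrightarrow> k mod m = 0"
    using least[of "k mod m"] m(1) by (cases "k mod m = 0") auto
  then show ?thesis using eq by (simp add: dvd_eq_mod_eq_0)
qed

lemma ex_primitive_root:
  fixes z :: "'a :: field"
  assumes "k > 0" "z ^ k = 1"
  obtains m where "is_primitive_root_of_unity m z" "m dvd k"
proof -
  define m where "m = (LEAST j. j > 0 \<and> z ^ j = 1)"
  have m: "m > 0 \<and> z ^ m = 1"
    unfolding m_def by (rule LeastI[of _ k]) (use assms in simp)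
  have "is_primitive_root_of_unity m z"
    unfolding is_primitive_root_of_unity_def
    using m not_less_Least[of _ "\<lambda>j. j > 0 \<and> z ^ j = 1"] by (auto simp: m_def)
  then show thesis using that assms(2) primitive_root_power_eq_1_iff by blast
qed

lemma primitive_root_inj_on:
  fixes z :: "'a :: field"
  assumes "is_primitive_root_of_unity m z"
  shows "inj_on (\<lambda>j. z ^ j) {..<m}"
proof -
  have z0: "z \<noteq> 0"
    using assms by (auto simp: is_primitive_root_of_unity_def power_0_left split: if_splits)
  have "i = j" if "i \<le> j" "j < m" "z ^ i = z ^ j" for i j
  proof -
    have "z ^ j = z ^ i * z ^ (j - i)" using that(1) by (simp flip: power_add)
    then have "z ^ (j - i) = 1" using that(3) z0 by simp
    then have "m dvd j - i" using assms primitive_root_power_eq_1_iff by blast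
    moreover have "j - i < m" using that(2) by simp
    ultimately have "j - i = 0" using nat_dvd_not_less by blast
    then show ?thesis using that(1) by simp
  qed
  then show ?thesis by (intro inj_onI) (metis lessThan_iff linear)
qed

text \<open>In a field X^m - 1 has at most m roots, and the powers of \<open>z\<close> with exponent
  below m already supply m distinct ones.\<close>

lemma root_of_unity_eq_power:
  fixes z w :: "'a :: field"
  assumes "is_primitive_root_of_unity m z" "w ^ m = 1"
  obtains j where "j < m" "w = z ^ j"
proof -
  let ?P = "Polynomial.monom 1 m - 1 :: 'a poly"
  have m: "m > 0" using assms(1) by (simp add: is_primitive_root_of_unity_def)
  have "Polynomial.coeff ?P m = 1" using m by simp
  then have P0: "?P \<noteq> 0" by (metis coeff_0 zero_neq_one)
  have roots: "{x. poly ?P x = 0} = {x. x ^ m = 1}" by (simp add: poly_monom)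
  have fin: "finite {x :: 'a. x ^ m = 1}" using poly_roots_finite[OF P0] unfolding roots .
  have "Polynomial.degree ?P \<le> m" by (intro degree_diff_le degree_monom_le) simp
  then have card: "card {x :: 'a. x ^ m = 1} \<le> m"
    using card_poly_roots_bound[OF P0] unfolding roots by linarith
  have "z ^ m = 1" using assms(1) by (simp add: is_primitive_root_of_unity_def)
  then have sub: "(\<lambda>j. z ^ j) ` {..<m} \<subseteq> {x. x ^ m = 1}"
    by (auto simp: mult.commute[of _ m] simp flip: power_mult) (simp add: power_mult)
  have "card ((\<lambda>j. z ^ j) ` {..<m}) = m"
    using card_image[OF primitive_root_inj_on[OF assms(1)]] by simp
  then have "(\<lambda>j. z ^ j) ` {..<m} = {x. x ^ m = 1}"
    using card_seteq[OF fin sub] card by simp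
  then show thesis using that assms(2) by blast
qed

text \<open>Instead of writing the gcd of a possibly infinite set as a Bezout combination, the proof
  uses the order of \<open>z\<close>: it divides every member of \<open>S\<close>, hence the
  gcd.\<close>

lemma power_Gcd_eq_1_iff:
  fixes z :: "'a :: field"
  shows "z ^ Gcd S = 1 \<longleftrightarrow> (\<forall>i\<in>S. z ^ i = 1)"
proof
  assume "z ^ Gcd S = 1"
  then show "\<forall>i\<in>S. z ^ i = 1" using Gcd_dvd by (metis dvdE power_mult power_one)
next
  assume *: "\<forall>i\<in>S. z ^ i = 1"
  show "z ^ Gcd S = 1"
  \<comment> \<open>Without a positive exponent in \<open>S\<close> the element \<open>z\<close>
    need not have finite order; the gcd is then 0 and \<open>z ^ 0 = 1\<close>.\<close>
  proof (cases "S \<subseteq> {0}")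
    case True
    then show ?thesis by (metis Gcd_0_iff power_0)
  next
    case False
    then obtain k where "k > 0" "k \<in> S" by auto
    then obtain m where m: "is_primitive_root_of_unity m z" using * ex_primitive_root by metis
    then have "m dvd Gcd S" using * primitive_root_power_eq_1_iff by (intro Gcd_greatest) blast
    then show ?thesis using m primitive_root_power_eq_1_iff by blast
  qed
qed

lemma primitive_root_to_ac_iff [simp]:
  "is_primitive_root_of_unity m (to_ac z) \<longleftrightarrow> is_primitive_root_of_unity m z"
  by (simp add: is_primitive_root_of_unity_def flip: to_ac_power)

section \<open>The eigengroup of a polynomial\<close>

lemma pcompose_power: "pcompose (p ^ k) q = pcompose p q ^ k" for p q :: "'a :: field poly"
  by (induction k) (simp_all add: pcompose_mult pcompose_1)

lemma subst_aut_id [simp]: "subst_aut 1 0 = id"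
  by (rule ext) (simp add: subst_aut_def)

lemma subst_aut_comp: "subst_aut l u \<circ> subst_aut l' u' = subst_aut (l * l') (u' + l' * u)"
  by (rule ext) (simp add: subst_aut_def pcompose_pCons pcompose_assoc[symmetric] mult.commute)

lemma subst_aut_eq_iff: "subst_aut l u = subst_aut l' u' \<longleftrightarrow> l = l' \<and> u = u'"
proof
  assume "subst_aut l u = subst_aut l' u'"
  then have "subst_aut l u [:0, 1:] = subst_aut l' u' [:0, 1:]" by simp
  then show "l = l' \<and> u = u'" by (simp add: subst_aut_def pcompose_pCons)
qed simp

lemma subst_aut_in_poly_aut:
  assumes "l \<noteq> 0"
  shows "subst_aut l u \<in> poly_aut"
proof (intro poly_autI)
  have "subst_aut l u \<circ> subst_aut (1 / l) (- (u / l)) = id"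
    "subst_aut (1 / l) (- (u / l)) \<circ> subst_aut l u = id"
    using assms by (simp_all add: subst_aut_comp)
  then show "bij (subst_aut l u)" by (metis o_bij)
qed (simp_all add: subst_aut_def pcompose_add pcompose_mult)

text \<open>An automorphism is the substitution of q, the image of x. Surjectivity gives p with
  p(q(x)) = x, and degrees multiply under composition, so q has degree 1.\<close>

lemma poly_aut_eq: "poly_aut = {subst_aut l u | l u. l \<noteq> 0}"
proof (intro equalityI subsetI)
  fix \<sigma> :: "'a poly \<Rightarrow> 'a poly" assume s: "\<sigma> \<in> poly_aut"
  obtain p where p: "\<sigma> p = [:0, 1:]" using poly_autD(5)[OF s] by (metis bij_pointE)
  have "Polynomial.degree p * Polynomial.degree (\<sigma> [:0, 1:]) = 1"
    using arg_cong[OF p, of Polynomial.degree]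
    unfolding poly_aut_pcompose[OF s, of p] degree_pcompose by simp
  then have "Polynomial.degree (\<sigma> [:0, 1:]) = 1" by simp
  then obtain u l where ul: "\<sigma> [:0, 1:] = [:u, l:]" "l \<noteq> 0"
    by (metis degree1_coeffs)
  then have "\<sigma> = subst_aut l u"
    using poly_aut_pcompose[OF s] by (intro ext) (metis subst_aut_def)
  then show "\<sigma> \<in> {subst_aut l u | l u. l \<noteq> 0}" using ul by blast
qed (auto simp: subst_aut_in_poly_aut)

section \<open>The eigenvalue equation f(lx + u) = c f(x)\<close>

lemma eigen_translation:
  fixes f :: "'a :: field_char_0 poly"
  assumes monic: "Polynomial.lead_coeff f = 1" and deg: "Polynomial.degree f = d" "d \<ge> 1"
    and l: "l \<noteq> 0" and c: "pcompose f [:u, l:] = Polynomial.smult c f"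
  shows "u = (1 - l) * - (Polynomial.coeff f (d - 1) / of_nat d)"
proof -
  obtain k where k: "d = Suc k" using deg(2) by (cases d) auto
  have top: "Polynomial.coeff f (Suc k) = 1" using monic deg k by simp
  have co: "Polynomial.coeff (pcompose f [:u, l:]) j =
      (\<Sum>i\<le>Suc k. Polynomial.coeff f i * Polynomial.coeff ([:u, l:] ^ i) j)" for j
    by (simp only: pcompose_as_sum deg k coeff_sum coeff_smult)
  have low: "Polynomial.coeff ([:u, l:] ^ i) j = 0" if "i < j" for i j
    using that l by (intro coeff_eq_0) (simp add: degree_power_eq)
  have lin: "Polynomial.coeff ([:u, l:] ^ i) j = of_nat (i choose j) * u ^ (i - j) * l ^ j" if "j \<le> i" for i j
    using that by (simp add: coeff_linear_poly_power)
  \<comment> \<open>The top coefficient determines the eigenvalue, c = l^d; the coefficient of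
    x^(d-1) then determines \<open>u\<close>.\<close>
  have "Polynomial.coeff (pcompose f [:u, l:]) (Suc k) = l ^ Suc k"
    unfolding co by (simp add: low lin top)
  then have c_eq: "c = l ^ Suc k" using c top by simp
  have "Polynomial.coeff (pcompose f [:u, l:]) k =
      Polynomial.coeff f k * l ^ k + of_nat (Suc k) * u * l ^ k"
  proof -
    have z: "(\<Sum>i<k. Polynomial.coeff f i * Polynomial.coeff ([:u, l:] ^ i) k) = 0"
      by (simp add: low)
    show ?thesis unfolding co using z
      by (simp add: lin top lessThan_Suc_atMost[symmetric] lessThan_Suc del: power_Suc of_nat_Suc)
  qed
  also have "Polynomial.coeff (pcompose f [:u, l:]) k = l ^ Suc k * Polynomial.coeff f k"
    unfolding c c_eq by simp
  finally have "l ^ k * (l * Polynomial.coeff f k) =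
      l ^ k * (Polynomial.coeff f k + of_nat (Suc k) * u)"
    by (simp add: algebra_simps)
  then have "l * Polynomial.coeff f k = Polynomial.coeff f k + of_nat (Suc k) * u"
    using l by simp
  \<comment> \<open>The degree d is invertible in characteristic zero, so the linear equation can be
    solved for \<open>u\<close>.\<close>
  moreover have "(of_nat (Suc k) :: 'a) \<noteq> 0" by (rule of_nat_neq_0)
  ultimately show ?thesis unfolding k
    by (simp add: field_simps del: of_nat_Suc)
qed

text \<open>The gcd in \<open>poly_exponent\<close> omits the index 0 while the right-hand side
  includes it; both agree because \<open>l ^ 0 = 1\<close>.\<close>

lemma poly_exponent_power_eq_1_iff:
  fixes l :: "'a :: field"
  shows "l ^ poly_exponent h = 1 \<longleftrightarrow> (\<forall>i. Polynomial.coeff h i \<noteq> 0 \<longrightarrow> l ^ i = 1)"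
  unfolding poly_exponent_def power_Gcd_eq_1_iff
  by (auto, metis One_nat_def Suc_le_eq gr0I power_0)

text \<open>Scaling multiplies the coefficient of x^i by l^i. The nonzero constant term of
  \<open>h\<close> forces c = l^s, and cancelling this factor leaves \<open>l ^ i = 1\<close> for
  every exponent i occurring in \<open>h\<close>.\<close>

lemma scaling_eigen_iff:
  fixes h :: "'a :: field poly"
  assumes "Polynomial.coeff h 0 \<noteq> 0" "l \<noteq> 0"
  shows "(\<exists>c. pcompose (Polynomial.monom 1 s * h) [:0, l:] =
            Polynomial.smult c (Polynomial.monom 1 s * h))
    \<longleftrightarrow> l ^ poly_exponent h = 1"
proof -
  have lin: "[:0, l:] ^ s = Polynomial.smult (l ^ s) (Polynomial.monom 1 s)"
    by (simp add: monom_altdef flip: smult_power)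
  have sc: "Polynomial.coeff (pcompose p [:0, l:]) i = l ^ i * Polynomial.coeff p i" for p i
    by (rule coeff_pcompose_linear)
  have mp: "pcompose (Polynomial.monom 1 s * h) [:0, l:] =
      Polynomial.monom 1 s * Polynomial.smult (l ^ s) (pcompose h [:0, l:])"
    by (simp add: pcompose_mult pcompose_monom lin)
  have "pcompose (Polynomial.monom 1 s * h) [:0, l:] =
      Polynomial.smult c (Polynomial.monom 1 s * h) \<longleftrightarrow>
    (\<forall>i. l ^ s * (l ^ i * Polynomial.coeff h i) = c * Polynomial.coeff h i)" for c
  proof -
    have "pcompose (Polynomial.monom 1 s * h) [:0, l:] =
        Polynomial.smult c (Polynomial.monom 1 s * h) \<longleftrightarrow>
      Polynomial.monom 1 s * Polynomial.smult (l ^ s) (pcompose h [:0, l:]) =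
        Polynomial.monom 1 s * Polynomial.smult c h"
      unfolding mp by simp
    also have "\<dots> \<longleftrightarrow> Polynomial.smult (l ^ s) (pcompose h [:0, l:]) = Polynomial.smult c h"
      by (subst mult_cancel_left) (simp add: monom_eq_0_iff)
    also have "\<dots> \<longleftrightarrow> (\<forall>i. l ^ s * (l ^ i * Polynomial.coeff h i) = c * Polynomial.coeff h i)"
      by (simp add: poly_eq_iff sc)
    finally show ?thesis .
  qed
  then have "(\<exists>c. pcompose (Polynomial.monom 1 s * h) [:0, l:] =
            Polynomial.smult c (Polynomial.monom 1 s * h)) \<longleftrightarrow>
      (\<exists>c. \<forall>i. l ^ s * (l ^ i * Polynomial.coeff h i) = c * Polynomial.coeff h i)" by simp
  also have "\<dots> \<longleftrightarrow> (\<forall>i. Polynomial.coeff h i \<noteq> 0 \<longrightarrow> l ^ i = 1)"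
  proof
    assume "\<exists>c. \<forall>i. l ^ s * (l ^ i * Polynomial.coeff h i) = c * Polynomial.coeff h i"
    then obtain c where c: "\<And>i. l ^ s * (l ^ i * Polynomial.coeff h i) = c * Polynomial.coeff h i"
      by blast
    have "c = l ^ s" using c[of 0] assms(1) by simp
    then show "\<forall>i. Polynomial.coeff h i \<noteq> 0 \<longrightarrow> l ^ i = 1" using c assms(2) by (simp, metis)
  next
    assume *: "\<forall>i. Polynomial.coeff h i \<noteq> 0 \<longrightarrow> l ^ i = 1"
    have "l ^ s * (l ^ i * Polynomial.coeff h i) = l ^ s * Polynomial.coeff h i" for i
      using * by (cases "Polynomial.coeff h i = 0") auto
    then show "\<exists>c. \<forall>i. l ^ s * (l ^ i * Polynomial.coeff h i) = c * Polynomial.coeff h i"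
      by blast
  qed
  finally show ?thesis by (simp add: poly_exponent_power_eq_1_iff)
qed

text \<open>Moving \<nu> to 0 turns the factor (x - \<nu>)^s of f into x^s, and the cofactor does
  not vanish at \<nu>. So the division by x^s in the eigenform is exact, and \<open>h\<close> is the
  polynomial whose exponent is n.\<close>

lemma translate_order_factor:
  fixes f :: "'a :: field poly"
  assumes "f \<noteq> 0"
  obtains h where "pcompose f [:\<nu>, 1:] = Polynomial.monom 1 (Polynomial.order \<nu> f) * h"
    "Polynomial.coeff h 0 \<noteq> 0"
proof -
  obtain q where q: "f = [:- \<nu>, 1:] ^ Polynomial.order \<nu> f * q" "\<not> [:- \<nu>, 1:] dvd q"
    using order_decomp[OF assms] by blast
  have "pcompose f [:\<nu>, 1:] =
      Polynomial.monom 1 (Polynomial.order \<nu> f) * pcompose q [:\<nu>, 1:]"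
    by (subst q(1)) (simp add: pcompose_mult pcompose_power pcompose_pCons monom_altdef)
  moreover have "Polynomial.coeff (pcompose q [:\<nu>, 1:]) 0 \<noteq> 0"
    using q(2) by (simp add: poly_0_coeff_0[symmetric] poly_pcompose poly_eq_0_iff_dvd)
  ultimately show thesis by (rule that)
qed

lemma pcompose_translation_eq_iff:
  fixes p q :: "'a :: field poly"
  shows "pcompose p [:a, 1:] = pcompose q [:a, 1:] \<longleftrightarrow> p = q"
proof
  assume "pcompose p [:a, 1:] = pcompose q [:a, 1:]"
  then have "pcompose (pcompose p [:a, 1:]) [:- a, 1:] = pcompose (pcompose q [:a, 1:]) [:- a, 1:]"
    by simp
  then show "p = q" by (simp add: pcompose_assoc[symmetric] pcompose_pCons)
qed simp

text \<open>\<open>eigen_translation\<close> leaves one candidate \<open>u\<close> for each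
  \<open>l\<close>, and translating \<nu> to 0 reduces the condition on \<open>l\<close> to
  \<open>scaling_eigen_iff\<close>. For \<open>n = 0\<close> the condition \<open>l ^ n = 1\<close>
  is void and every nonzero \<open>l\<close> occurs.\<close>

lemma eigengroup_eigenform:
  fixes f :: "'a :: field_char_0 poly"
  assumes monic: "Polynomial.lead_coeff f = 1" and deg: "Polynomial.degree f \<ge> 1"
    and eigenform: "is_eigenform f \<nu> s n g"
  shows "eigengroup f = {subst_aut l ((1 - l) * \<nu>) | l. l \<noteq> 0 \<and> l ^ n = 1}"
proof -
  have nu: "\<nu> = - (Polynomial.coeff f (Polynomial.degree f - 1) / of_nat (Polynomial.degree f))"
    and s: "s = Polynomial.order \<nu> f"
    and n: "n = poly_exponent (pcompose f [:\<nu>, 1:] div Polynomial.monom 1 s)"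
    using eigenform unfolding is_eigenform_def by blast+
  have "f \<noteq> 0" using deg by auto
  then obtain h where h: "pcompose f [:\<nu>, 1:] = Polynomial.monom 1 s * h"
    "Polynomial.coeff h 0 \<noteq> 0"
    using translate_order_factor unfolding s by blast
  have nh: "n = poly_exponent h" unfolding n h(1) by (simp add: monom_eq_0_iff)
  have iff: "(\<exists>c. subst_aut l ((1 - l) * \<nu>) f = Polynomial.smult c f) \<longleftrightarrow> l ^ n = 1"
    if "l \<noteq> 0" for l
  proof -
    \<comment> \<open>Both sides are f(lx + \<nu>), since l(x + \<nu>) + (1 - l)\<nu> = lx +
      \<nu>.\<close>
    have "pcompose (pcompose f [:(1 - l) * \<nu>, l:]) [:\<nu>, 1:] =
        pcompose (pcompose f [:\<nu>, 1:]) [:0, l:]"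
      by (simp add: pcompose_assoc[symmetric] pcompose_pCons algebra_simps)
    then have "subst_aut l ((1 - l) * \<nu>) f = Polynomial.smult c f \<longleftrightarrow>
        pcompose (Polynomial.monom 1 s * h) [:0, l:] = Polynomial.smult c (Polynomial.monom 1 s * h)" for c
      by (subst pcompose_translation_eq_iff[of _ \<nu>, symmetric])
        (simp add: subst_aut_def pcompose_smult h(1))
    then show ?thesis using scaling_eigen_iff[OF h(2) that] nh by simp
  qed
  have "u = (1 - l) * \<nu>" if "l \<noteq> 0" "subst_aut l u f = Polynomial.smult c f" for l u c
    using eigen_translation[OF monic refl deg that(1) that(2)[unfolded subst_aut_def]] nu by simp
  then show ?thesis
    unfolding eigengroup_def poly_aut_eq using iff by blast
qed

section \<open>The group of affine substitutions fixing the point \<nu>\<close>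

lemma subst_aut_fix_comp:
  "subst_aut l ((1 - l) * \<nu>) \<circ> subst_aut l' ((1 - l') * \<nu>) = subst_aut (l * l') ((1 - l * l') * \<nu>)"
  by (simp add: subst_aut_comp algebra_simps)

lemma subst_aut_fix_funpow:
  "subst_aut l ((1 - l) * \<nu>) ^^ j = subst_aut (l ^ j) ((1 - l ^ j) * \<nu>)"
  by (induction j) (simp_all add: subst_aut_fix_comp)

text \<open>The subgroup \<open>S\<close> contains \<open>x\<close> and so bounds the generated
  group from above; conversely, iteration yields every power of \<open>x\<close>. The carrier
  \<open>A\<close> is general because generation is studied both among all automorphisms and inside
  the eigengroup itself.\<close>

lemma generate_comp_group_singleton:
  assumes "group (comp_group A)" "subgroup S (comp_group A)"
    and S: "S = {x ^^ j | j. j \<le> N}" and "x \<in> S"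
  shows "generate (comp_group A) {x} = S"
proof
  show "generate (comp_group A) {x} \<subseteq> S"
    using assms by (intro group.generate_subgroup_incl) auto
  have "x ^^ j \<in> generate (comp_group A) {x}" for j
  proof (induction j)
    case 0
    show ?case using generate.one[of "comp_group A" "{x}"] by (simp add: comp_group_def id_def)
  next
    case (Suc j)
    show ?case
      using generate.eng[OF generate.incl[of x "{x}" "comp_group A"] Suc]
      by (simp add: comp_group_def o_def)
  qed
  then show "S \<subseteq> generate (comp_group A) {x}" unfolding S by blast
qed

lemma eigengroup_subset: "eigengroup f \<subseteq> poly_aut"
  by (auto simp: eigengroup_def)

lemma group_eigengroup: "group (comp_group (eigengroup f))"
  using subgroup.subgroup_is_group[OF subgroup_eigengroup group_poly_aut]
  by (simp add: comp_group_def)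

lemma iso_scalings:
  fixes \<nu> :: "'a :: field"
  defines "S \<equiv> {subst_aut l ((1 - l) * \<nu>) | l. l \<noteq> 0}"
  obtains \<phi> where "\<phi> \<in> iso (comp_group S) (mult_group TYPE('a))"
    "\<And>l. \<phi> (subst_aut l ((1 - l) * \<nu>)) = l"
proof
  \<comment> \<open>The multiplier \<open>l\<close> is recovered as the coefficient of x in the
    image of x.\<close>
  define \<phi> where "\<phi> \<sigma> = Polynomial.coeff (\<sigma> [:0, 1:]) 1" for \<sigma> :: "'a poly \<Rightarrow> 'a poly"
  show \<phi>: "\<phi> (subst_aut l ((1 - l) * \<nu>)) = l" for l
    by (simp add: \<phi>_def subst_aut_def pcompose_pCons)
  have "bij_betw \<phi> S (UNIV - {0})"
    by (intro bij_betwI[where g = "\<lambda>l. subst_aut l ((1 - l) * \<nu>)"]) (auto simp: S_def \<phi>)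
  then show "\<phi> \<in> iso (comp_group S) (mult_group TYPE('a))"
    by (auto simp: iso_def hom_def comp_group_def ring_of_type_algebra_def S_def \<phi> subst_aut_fix_comp)
qed

section \<open>Extension to the algebraic closure\<close>

lemma poly_to_ac_eq_iff [simp]: "poly_to_ac p = poly_to_ac q \<longleftrightarrow> p = q"
  using inj_poly_to_ac by (auto dest: injD)

lemma degree_poly_to_ac [simp]: "Polynomial.degree (poly_to_ac p) = Polynomial.degree p"
  by (simp add: degree_map_poly)

lemma coeff_poly_to_ac [simp]: "Polynomial.coeff (poly_to_ac p) i = to_ac (Polynomial.coeff p i)"
  by (simp add: coeff_map_poly)

lemma poly_to_ac_smult: "poly_to_ac (Polynomial.smult c p) = Polynomial.smult (to_ac c) (poly_to_ac p)"
  by (intro poly_eqI) simp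

lemma poly_to_ac_pCons [simp]: "poly_to_ac (pCons a p) = pCons (to_ac a) (poly_to_ac p)"
  by (simp add: map_poly_pCons)

lemma poly_to_ac_1 [simp]: "poly_to_ac 1 = 1"
  by (simp add: one_pCons)

section \<open>Eigenforms under extension of scalars\<close>

lemma linear_power_root:
  fixes a :: "'a :: field_char_0"
  assumes "f = [:- a, 1:] ^ Polynomial.degree f" "Polynomial.degree f \<ge> 1"
  shows "a = - (Polynomial.coeff f (Polynomial.degree f - 1) / of_nat (Polynomial.degree f))"
proof -
  have "Polynomial.coeff f (Polynomial.degree f - 1) = - (of_nat (Polynomial.degree f) * a)"
    by (subst assms(1), subst coeff_linear_poly_power)
      (use assms(2) binomial_symmetric[of "Polynomial.degree f - 1" "Polynomial.degree f"] in simp_all)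
  then show ?thesis using assms(2) by simp
qed

text \<open>After all factors x - a are split off over K, the cofactor has a nonzero value at
  \<open>a\<close>, and the embedding keeps that value nonzero.\<close>

lemma order_poly_to_ac:
  fixes f :: "'a :: field poly"
  assumes "f \<noteq> 0"
  shows "Polynomial.order (to_ac a) (poly_to_ac f) = Polynomial.order a f"
proof -
  obtain q where q: "f = [:- a, 1:] ^ Polynomial.order a f * q" "\<not> [:- a, 1:] dvd q"
    using order_decomp[OF assms] by blast
  have "poly (poly_to_ac q) (to_ac a) = to_ac (poly q a)"
    by (induction q) simp_all
  then have nz: "poly (poly_to_ac q) (to_ac a) \<noteq> 0" using q(2) by (simp add: poly_eq_0_iff_dvd)
  have "poly_to_ac f = [:- to_ac a, 1:] ^ Polynomial.order a f * poly_to_ac q"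
    by (subst q(1)) (simp add: poly_to_ac_mult poly_to_ac_power)
  moreover have "\<not> [:- to_ac a, 1:] ^ Polynomial.order a f * [:- to_ac a, 1:] dvd
      [:- to_ac a, 1:] ^ Polynomial.order a f * poly_to_ac q"
    using nz by (subst dvd_mult_cancel_left) (simp add: poly_eq_0_iff_dvd)
  ultimately show ?thesis
    by (intro order_unique_lemma) (simp_all only: power_Suc2 dvd_triv_left not_False_eq_True)
qed

text \<open>Each clause of the definition is preserved by the embedding of K. Together with
  uniqueness over the closure this places \<nu> and the coefficients of g in K.\<close>

lemma is_eigenform_poly_to_ac:
  fixes f :: "'a :: field_char_0 poly"
  assumes deg: "Polynomial.degree f \<ge> 1" and ef: "is_eigenform f \<nu> s n g"
  shows "is_eigenform (poly_to_ac f) (to_ac \<nu>) s n (poly_to_ac g)"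
proof -
  have nu: "\<nu> = - (Polynomial.coeff f (Polynomial.degree f - 1) / of_nat (Polynomial.degree f))"
    and s: "s = Polynomial.order \<nu> f"
    and n: "n = poly_exponent (pcompose f [:\<nu>, 1:] div Polynomial.monom 1 s)"
    and g: "Polynomial.lead_coeff g = 1"
    and dg: "Polynomial.degree f = s + n * Polynomial.degree g"
    and feq: "f = [:- \<nu>, 1:] ^ s * pcompose g ([:- \<nu>, 1:] ^ n)"
    and g1: "(\<exists>a. f = [:- a, 1:] ^ Polynomial.degree f) \<longrightarrow> g = 1"
    using ef unfolding is_eigenform_def by blast+
  have "f \<noteq> 0" using deg by auto
  then obtain h where h: "pcompose f [:\<nu>, 1:] = Polynomial.monom 1 s * h"
    using translate_order_factor unfolding s by blast
  have "pcompose (poly_to_ac f) [:to_ac \<nu>, 1:] = poly_to_ac (pcompose f [:\<nu>, 1:])"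
    by (simp add: poly_to_ac_pcompose)
  also have "\<dots> = Polynomial.monom 1 s * poly_to_ac h"
    unfolding h poly_to_ac_mult by (simp add: map_poly_monom)
  finally have h': "pcompose (poly_to_ac f) [:to_ac \<nu>, 1:] = Polynomial.monom 1 s * poly_to_ac h" .
  have nu': "to_ac \<nu> = - (Polynomial.coeff (poly_to_ac f) (Polynomial.degree (poly_to_ac f) - 1) /
      of_nat (Polynomial.degree (poly_to_ac f)))"
    unfolding nu by simp
  have g1': "poly_to_ac g = 1" if "poly_to_ac f = [:- a, 1:] ^ Polynomial.degree (poly_to_ac f)" for a
  proof -
    \<comment> \<open>A single root in the closure is determined by the degree and the coefficient
      of x^(d-1), so it comes from K and the single-root convention already applies to
      \<open>f\<close> itself.\<close>
    have "a = to_ac \<nu>" using linear_power_root[OF that] deg nu' by simp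
    then have "poly_to_ac f = poly_to_ac ([:- \<nu>, 1:] ^ Polynomial.degree f)"
      using that by (simp add: poly_to_ac_power)
    then show ?thesis using g1 by auto
  qed
  show ?thesis
    unfolding is_eigenform_def
  proof (intro conjI)
    show "s = Polynomial.order (to_ac \<nu>) (poly_to_ac f)"
      using order_poly_to_ac[OF \<open>f \<noteq> 0\<close>] s by metis
    show "n = poly_exponent (pcompose (poly_to_ac f) [:to_ac \<nu>, 1:] div Polynomial.monom 1 s)"
      unfolding h' n h by (simp add: monom_eq_0_iff poly_exponent_def)
    show "Polynomial.degree (poly_to_ac f) = s + n * Polynomial.degree (poly_to_ac g)"
      using dg by simp
    show "poly_to_ac f = [:- to_ac \<nu>, 1:] ^ s * pcompose (poly_to_ac g) ([:- to_ac \<nu>, 1:] ^ n)"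
      by (subst feq) (simp add: poly_to_ac_mult poly_to_ac_power poly_to_ac_pcompose)
  qed (use nu' g g1' in auto)
qed

section \<open>Eigengroups under extension of scalars\<close>

lemma eigengroup_poly_ext_iff:
  fixes f :: "'a :: field poly"
  assumes "\<sigma> \<in> poly_aut"
  shows "poly_ext \<sigma> \<in> eigengroup (poly_to_ac f) \<longleftrightarrow> \<sigma> \<in> eigengroup f"
proof -
  have "(\<exists>c. poly_to_ac (\<sigma> f) = Polynomial.smult c (poly_to_ac f)) \<longleftrightarrow>
      (\<exists>c. \<sigma> f = Polynomial.smult c f)"
  proof
    assume "\<exists>c. poly_to_ac (\<sigma> f) = Polynomial.smult c (poly_to_ac f)"
    then obtain c where c: "poly_to_ac (\<sigma> f) = Polynomial.smult c (poly_to_ac f)" by blast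
    show "\<exists>c. \<sigma> f = Polynomial.smult c f"
    proof (cases "f = 0")
      case True
      then show ?thesis using poly_autD(4)[OF assms, of 0] by simp
    next
      case False
      \<comment> \<open>The eigenvalue \<open>c\<close> is given only in the closure. Comparing
        coefficients at the degree of \<open>f\<close> exhibits it as a quotient of elements of
        K.\<close>
      let ?e = "Polynomial.coeff (\<sigma> f) (Polynomial.degree f) / Polynomial.lead_coeff f"
      have "to_ac (Polynomial.coeff (\<sigma> f) (Polynomial.degree f)) = c * to_ac (Polynomial.lead_coeff f)"
        using arg_cong[OF c, of "\<lambda>p. Polynomial.coeff p (Polynomial.degree f)"] by simp
      then have "c = to_ac ?e" using False by (simp add: field_simps)
      then have "poly_to_ac (\<sigma> f) = poly_to_ac (Polynomial.smult ?e f)"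
        using c by (simp only: poly_to_ac_smult)
      then show ?thesis by (auto simp only: poly_to_ac_eq_iff)
    qed
  qed (auto simp: poly_to_ac_smult)
  then show ?thesis
    using assms by (simp add: eigengroup_def poly_ext_poly_aut poly_ext_poly_to_ac)
qed

text \<open>If lx + u has coefficients in K, then the same l and u define an automorphism over K
  with the given extension. This reconciles the two descriptions of G_f(K) inside the eigengroup
  over the closure.\<close>

lemma poly_ext_image_poly_aut:
  "poly_ext ` poly_aut = {\<sigma> \<in> poly_aut. \<sigma> [:0, 1:] \<in> range poly_to_ac}"
proof (intro equalityI subsetI)
  fix \<sigma> :: "'a alg_closure poly \<Rightarrow> 'a alg_closure poly"
  assume "\<sigma> \<in> poly_ext ` poly_aut"
  then obtain \<tau> where t: "\<tau> \<in> poly_aut" "\<sigma> = poly_ext \<tau>" by blast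
  then have "\<sigma> [:0, 1:] = poly_to_ac (\<tau> [:0, 1:])"
    using poly_ext_poly_to_ac[OF t(1), of "[:0, 1:]"] by simp
  then show "\<sigma> \<in> {\<sigma> \<in> poly_aut. \<sigma> [:0, 1:] \<in> range poly_to_ac}"
    using t poly_ext_poly_aut by auto
next
  fix \<sigma> :: "'a alg_closure poly \<Rightarrow> 'a alg_closure poly"
  assume *: "\<sigma> \<in> {\<sigma> \<in> poly_aut. \<sigma> [:0, 1:] \<in> range poly_to_ac}"
  then obtain l u q where s: "\<sigma> = subst_aut l u" "l \<noteq> 0" "\<sigma> [:0, 1:] = poly_to_ac q"
    by (auto simp: poly_aut_eq)
  then have q: "poly_to_ac q = [:u, l:]" by (simp add: subst_aut_def pcompose_pCons)
  have ul: "u = to_ac (Polynomial.coeff q 0)" "l = to_ac (Polynomial.coeff q 1)"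
    using arg_cong[OF q, of "\<lambda>p. Polynomial.coeff p 0"] arg_cong[OF q, of "\<lambda>p. Polynomial.coeff p 1"]
    by simp_all
  let ?\<tau> = "subst_aut (Polynomial.coeff q 1) (Polynomial.coeff q 0)"
  have t: "?\<tau> \<in> poly_aut" using s(2) ul(2) by (intro subst_aut_in_poly_aut) auto
  have "poly_ext ?\<tau> = \<sigma>"
    by (rule ext) (simp add: poly_ext_pcompose[OF t] s(1) ul subst_aut_def pcompose_pCons
        del: One_nat_def)
  then show "\<sigma> \<in> poly_ext ` poly_aut" using t by blast
qed

section \<open>Roots of unity contained in K\<close>

lemma power_in_range_to_ac: "z \<in> range to_ac \<Longrightarrow> z ^ j \<in> range to_ac"
  by (auto simp flip: to_ac_power)

text \<open>
  The exponents \<open>k\<close> for which the \<open>k\<close>-th power of a primitive \<open>n\<close>-th root of unity lies in \<open>K\<close> are the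
  multiples of some divisor \<open>d\<close> of \<open>n\<close>; the maximum is \<open>n / d\<close>.
\<close>
lemma max_root_of_unity_in_range:
  fixes \<zeta> :: "nat \<Rightarrow> 'k :: field_char_0 alg_closure"
  assumes n: "n > 0" and zeta: "\<And>m. m \<ge> 1 \<Longrightarrow> is_primitive_root_of_unity m (\<zeta> m)"
  obtains l where "to_ac l = \<zeta> (Max {m. m dvd n \<and> \<zeta> m \<in> range to_ac})"
    "is_primitive_root_of_unity (Max {m. m dvd n \<and> \<zeta> m \<in> range to_ac}) l"
    "\<And>w :: 'k. w ^ n = 1 \<longleftrightarrow> w ^ Max {m. m dvd n \<and> \<zeta> m \<in> range to_ac} = 1"
proof -
  define A where "A = {m. m dvd n \<and> \<zeta> m \<in> range to_ac}"
  define z where "z = \<zeta> n"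
  have z: "is_primitive_root_of_unity n z" using zeta n by (simp add: z_def)
  have zn: "z ^ n = 1" using primitive_root_power_eq_1_iff[OF z] by simp
  have z0: "z \<noteq> 0" using zn n by (auto simp: power_0_left)
  define d where "d = (LEAST k. k > 0 \<and> z ^ k \<in> range to_ac)"
  have d: "d > 0 \<and> z ^ d \<in> range to_ac"
    unfolding d_def by (rule LeastI[of _ n]) (use n zn in \<open>auto intro: image_eqI[of _ _ 1]\<close>)
  have dvd: "d dvd k" if k: "z ^ k \<in> range to_ac" for k
  proof -
    obtain a where a: "z ^ d = to_ac a" using d by blast
    obtain b where b: "z ^ k = to_ac b" using k by blast
    \<comment> \<open>Division with remainder in the exponent: \<open>z ^ (k mod d)\<close> is a
      quotient of elements of K, so minimality of \<open>d\<close> makes the remainder 0.\<close>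
    have "z ^ k = (z ^ d) ^ (k div d) * z ^ (k mod d)"
      by (simp flip: power_mult power_add)
    moreover have "a \<noteq> 0" using a z0 by auto
    ultimately have "z ^ (k mod d) = to_ac (b / a ^ (k div d))"
      using a b by (simp add: field_simps)
    then have "z ^ (k mod d) \<in> range to_ac" by blast
    then have "\<not> k mod d > 0"
      using not_less_Least[of "k mod d" "\<lambda>k. k > 0 \<and> z ^ k \<in> range to_ac"] d by (auto simp flip: d_def)
    then show ?thesis by (simp add: dvd_eq_mod_eq_0)
  qed
  have "d dvd n" using dvd[of n] zn by (auto intro: image_eqI[of _ _ 1])
  then obtain M where M: "n = d * M" by blast
  have M0: "M > 0" using M n by auto
  \<comment> \<open>Every n-th root of unity in K is some \<open>z ^ k\<close> with \<open>d\<close>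
    dividing \<open>k\<close>, and then n = dM divides kM.\<close>
  have w_M: "w ^ M = 1" if "w ^ n = 1" for w :: 'k
  proof -
    have "to_ac w ^ n = 1" using that by (simp flip: to_ac_power)
    then obtain k where k: "to_ac w = z ^ k" using root_of_unity_eq_power[OF z] by metis
    then have "d dvd k" using dvd by (metis rangeI)
    then have "n dvd k * M" unfolding M by simp
    then have "to_ac (w ^ M) = to_ac 1"
      using primitive_root_power_eq_1_iff[OF z] by (simp add: k flip: power_mult)
    then show ?thesis by (simp only: to_ac_eq_iff)
  qed
  have fin: "finite A" using n by (intro finite_subset[of A "{..n}"]) (auto simp: A_def dvd_imp_le)
  have "(z ^ d) ^ k = 1 \<longleftrightarrow> M dvd k" for k
    using primitive_root_power_eq_1_iff[OF z] d by (simp add: M flip: power_mult)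
  then have zd: "is_primitive_root_of_unity M (z ^ d)"
    using M0 by (auto simp: is_primitive_root_of_unity_def dest: dvd_imp_le)
  \<comment> \<open>The roots \<open>\<zeta> m\<close> for different m are not assumed to be
    compatible, so \<open>\<zeta> M\<close> may differ from \<open>z ^ d\<close>. It is still a
    power of \<open>z ^ d\<close> and therefore lies in K.\<close>
  have "\<zeta> M ^ M = 1" using zeta[of M] M0 by (simp add: is_primitive_root_of_unity_def)
  then obtain j where "\<zeta> M = (z ^ d) ^ j" using root_of_unity_eq_power[OF zd] by metis
  then have MA: "M \<in> A" using power_in_range_to_ac[of "z ^ d" j] d M by (simp add: A_def)
  \<comment> \<open>A member m of \<open>A\<close> yields an element of K of order m whose n-th
    power is 1; by \<open>w_M\<close> its M-th power is 1 as well, so m divides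
    \<open>M\<close>.\<close>
  have le: "m \<le> M" if "m \<in> A" for m
  proof -
    obtain l where l: "to_ac l = \<zeta> m" "m dvd n" using \<open>m \<in> A\<close> by (auto simp: A_def)
    have "m \<ge> 1" using l(2) n by (auto intro: Suc_leI gr0I)
    then have "is_primitive_root_of_unity m (to_ac l)" using zeta l by simp
    then have lm: "is_primitive_root_of_unity m l" by simp
    then have "l ^ n = 1" using l(2) primitive_root_power_eq_1_iff by blast
    then have "m dvd M" using w_M lm primitive_root_power_eq_1_iff by blast
    then show ?thesis using M0 by (rule dvd_imp_le)
  qed
  have Max: "Max A = M" using fin MA le by (intro Max_eqI)
  obtain l where l: "to_ac l = \<zeta> M" using MA by (auto simp: A_def)
  have "is_primitive_root_of_unity M (to_ac l)" using zeta[of M] M0 l by simp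
  then have "is_primitive_root_of_unity M l" by simp
  moreover have "w ^ n = 1 \<longleftrightarrow> w ^ M = 1" for w :: 'k
    using w_M by (auto simp: M mult.commute[of d] power_mult)
  ultimately show thesis using that l Max unfolding A_def by metis
qed

text \<open>For \<open>n = 0\<close> the eigenform is a constant multiple of (x - \<nu>)^s, which
  cannot vanish at two distinct points unless it is zero.\<close>

lemma eigenform_exponent_pos:
  fixes f :: "'a :: field_char_0 poly"
  assumes "f \<noteq> 0" "is_eigenform f \<nu> s n g" "a \<noteq> b" "poly f a = 0" "poly f b = 0"
  shows "n > 0"
proof (rule ccontr)
  assume "\<not> n > 0"
  then have f: "f = [:- \<nu>, 1:] ^ s * pcompose g 1"
    using assms(2) unfolding is_eigenform_def by (metis gr0I power_0)
  have p: "poly f x = (x - \<nu>) ^ s * poly g 1" for x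
    by (subst f) (simp add: poly_pcompose)
  then have "poly g 1 = 0 \<or> a = \<nu>" "poly g 1 = 0 \<or> b = \<nu>" using assms(4,5) by auto
  then have "poly g 1 = 0" using assms(3) by auto
  then have "poly f x = 0" for x using p by simp
  then show False using assms(1) poly_all_0_iff_0 by blast
qed

section \<open>Descent to K and the structure of the eigengroup\<close>

theorem theorem1p4:
  fixes f :: "'k :: field_char_0 poly"
    and \<nu> :: "'k alg_closure" and s n :: nat and g :: "'k alg_closure poly"
    and \<zeta> :: "nat \<Rightarrow> 'k alg_closure"
  assumes monic: "Polynomial.lead_coeff f = 1"
    and degree: "Polynomial.degree f \<ge> 1"
    and eigenform: "is_eigenform (poly_to_ac f) \<nu> s n g"
    and zeta: "\<And>m. m \<ge> 1 \<Longrightarrow> is_primitive_root_of_unity m (\<zeta> m)"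
  shows "\<exists>\<nu>\<^sub>0 g\<^sub>0. \<nu> = to_ac \<nu>\<^sub>0 \<and> g = poly_to_ac g\<^sub>0 \<and>
    \<comment> \<open>(1)\<close>
    poly_ext ` eigengroup f = eigengroup (poly_to_ac f) \<inter> poly_ext ` poly_aut \<and>
    poly_ext ` eigengroup f = {\<sigma> \<in> eigengroup (poly_to_ac f). \<sigma> [:0, 1:] \<in> range poly_to_ac} \<and>
    \<comment> \<open>(2)\<close>
    (poly_to_ac f = [:- \<nu>, 1:] ^ Polynomial.degree f \<longrightarrow>
       eigengroup f = {subst_aut l ((1 - l) * \<nu>\<^sub>0) | l. l \<noteq> 0} \<and>
       (\<exists>\<phi> \<in> iso (comp_group (eigengroup f)) (mult_group TYPE('k)).
          \<forall>l. l \<noteq> 0 \<longrightarrow> \<phi> (subst_aut l ((1 - l) * \<nu>\<^sub>0)) = l)) \<and>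
    \<comment> \<open>(3)\<close>
    ((\<exists>a b. a \<noteq> b \<and> poly (poly_to_ac f) a = 0 \<and> poly (poly_to_ac f) b = 0) \<longrightarrow>
       (eigengroup f \<noteq> {id} \<longleftrightarrow> n > 1 \<and> (\<exists>m\<ge>2. m dvd n \<and> \<zeta> m \<in> range to_ac)) \<and>
       (\<forall>n'. n > 1 \<and> n' = Max {m. m dvd n \<and> \<zeta> m \<in> range to_ac} \<and> n' \<ge> 2 \<longrightarrow>
          (\<exists>l. to_ac l = \<zeta> n' \<and>
             eigengroup f = generate (comp_group poly_aut) {subst_aut l ((1 - l) * \<nu>\<^sub>0)} \<and>
             eigengroup f = {(subst_aut l ((1 - l) * \<nu>\<^sub>0)) ^^ j | j. j \<le> n' - 1} \<and>
             cyclic_group (comp_group (eigengroup f)) \<and>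
             Coset.order (comp_group (eigengroup f)) = n')))"
proof -
  have f0: "f \<noteq> 0" using degree by auto
  obtain \<nu>\<^sub>0 s\<^sub>0 n\<^sub>0 g\<^sub>0 where ef0: "is_eigenform f \<nu>\<^sub>0 s\<^sub>0 n\<^sub>0 g\<^sub>0"
    using is_eigenform_ex1[OF monic degree] by auto
  have ac: "Polynomial.lead_coeff (poly_to_ac f) = 1" "Polynomial.degree (poly_to_ac f) \<ge> 1"
    using monic degree by auto
  \<comment> \<open>The eigenform over K maps to an eigenform over the closure, where there is only
    one.\<close>
  have "(\<nu>, s, n, g) = (to_ac \<nu>\<^sub>0, s\<^sub>0, n\<^sub>0, poly_to_ac g\<^sub>0)"
    using is_eigenform_ex1[OF ac] eigenform is_eigenform_poly_to_ac[OF degree ef0]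
    by (metis (mono_tags, lifting) case_prod_conv)
  then have \<nu>: "\<nu> = to_ac \<nu>\<^sub>0" and g: "g = poly_to_ac g\<^sub>0" and ef: "is_eigenform f \<nu>\<^sub>0 s n g\<^sub>0"
    using ef0 by auto
  let ?\<sigma> = "\<lambda>l. subst_aut l ((1 - l) * \<nu>\<^sub>0)"
  have eg: "eigengroup f = {?\<sigma> l | l. l \<noteq> 0 \<and> l ^ n = 1}"
    by (rule eigengroup_eigenform[OF monic degree ef])
  have inter: "poly_ext ` eigengroup f = eigengroup (poly_to_ac f) \<inter> poly_ext ` poly_aut"
    using eigengroup_poly_ext_iff eigengroup_subset by blast
  then have restr: "poly_ext ` eigengroup f =
      {\<sigma> \<in> eigengroup (poly_to_ac f). \<sigma> [:0, 1:] \<in> range poly_to_ac}"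
    unfolding poly_ext_image_poly_aut using eigengroup_subset by blast
  have single: "eigengroup f = {?\<sigma> l | l. l \<noteq> 0} \<and>
       (\<exists>\<phi> \<in> iso (comp_group (eigengroup f)) (mult_group TYPE('k)).
          \<forall>l. l \<noteq> 0 \<longrightarrow> \<phi> (?\<sigma> l) = l)"
    if "poly_to_ac f = [:- \<nu>, 1:] ^ Polynomial.degree f"
  proof -
    have "poly_to_ac f = [:- \<nu>, 1:] ^ Polynomial.degree (poly_to_ac f)"
      unfolding degree_poly_to_ac by (fact that)
    \<comment> \<open>The convention for a single root gives g = 1. Hence s = d, the quotient of f(x
      + \<nu>) by x^s is 1, and n is the gcd of the empty set, namely 0.\<close>
    then have g1: "g = 1" using eigenform unfolding is_eigenform_def by blast
    have "Polynomial.degree (poly_to_ac f) = s + n * Polynomial.degree g"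
      and n: "n = poly_exponent (pcompose (poly_to_ac f) [:\<nu>, 1:] div Polynomial.monom 1 s)"
      using eigenform unfolding is_eigenform_def by blast+
    then have "s = Polynomial.degree f" using g1 by simp
    then have "pcompose (poly_to_ac f) [:\<nu>, 1:] = Polynomial.monom 1 s"
      using that by (simp add: pcompose_power pcompose_pCons monom_altdef)
    then have "n = poly_exponent (1 :: 'k alg_closure poly)"
      using n by (simp add: monom_eq_0_iff)
    also have "\<dots> = 0" by (auto simp: poly_exponent_def one_pCons coeff_pCons gr0_conv_Suc split: nat.splits)
    finally have "eigengroup f = {?\<sigma> l | l. l \<noteq> 0}" using eg by simp
    then show ?thesis using iso_scalings[of \<nu>\<^sub>0] by metis
  qed
  have multiple: "(eigengroup f \<noteq> {id} \<longleftrightarrow> n > 1 \<and> (\<exists>m\<ge>2. m dvd n \<and> \<zeta> m \<in> range to_ac)) \<and>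
       (\<forall>n'. n > 1 \<and> n' = Max {m. m dvd n \<and> \<zeta> m \<in> range to_ac} \<and> n' \<ge> 2 \<longrightarrow>
          (\<exists>l. to_ac l = \<zeta> n' \<and>
             eigengroup f = generate (comp_group poly_aut) {?\<sigma> l} \<and>
             eigengroup f = {(?\<sigma> l) ^^ j | j. j \<le> n' - 1} \<and>
             cyclic_group (comp_group (eigengroup f)) \<and>
             Coset.order (comp_group (eigengroup f)) = n'))"
    if two: "\<exists>a b. a \<noteq> b \<and> poly (poly_to_ac f) a = 0 \<and> poly (poly_to_ac f) b = 0"
  proof (intro conjI allI impI)
    have n0: "n > 0"
      using two eigenform_exponent_pos[OF _ eigenform] ac(2) by fastforce
    \<comment> \<open>As n is positive, \<open>l ^ n = 1\<close> excludes
      \<open>l = 0\<close>.\<close>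
    have eg': "eigengroup f = {?\<sigma> l | l. l ^ n = 1}"
      unfolding eg using n0 by (auto simp: power_0_left)
    have id_iff: "?\<sigma> l = id \<longleftrightarrow> l = 1" for l
      using subst_aut_eq_iff[of l "(1 - l) * \<nu>\<^sub>0" 1 0] by auto
    have "?\<sigma> 1 \<in> eigengroup f" unfolding eg' using power_one by blast
    then have "id \<in> eigengroup f" by simp
    then have nontriv: "eigengroup f \<noteq> {id} \<longleftrightarrow> (\<exists>l :: 'k. l ^ n = 1 \<and> l \<noteq> 1)"
      unfolding eg' using id_iff by blast
    show "eigengroup f \<noteq> {id} \<longleftrightarrow> n > 1 \<and> (\<exists>m\<ge>2. m dvd n \<and> \<zeta> m \<in> range to_ac)"
      unfolding nontriv
    proof (intro iffI conjI)
      assume "\<exists>l :: 'k. l ^ n = 1 \<and> l \<noteq> 1"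
      then obtain l :: 'k where l: "l ^ n = 1" "l \<noteq> 1" by blast
      obtain m where m: "is_primitive_root_of_unity m l" "m dvd n"
        using ex_primitive_root[OF n0 l(1)] by blast
      have m2: "m \<ge> 2"
      proof (rule ccontr)
        assume "\<not> m \<ge> 2"
        then have "m = 1" using m(1) by (auto simp: is_primitive_root_of_unity_def)
        then show False using m(1) l(2) by (simp add: is_primitive_root_of_unity_def)
      qed
      have "m \<le> n" using m(2) n0 by (rule dvd_imp_le)
      then show "n > 1" using m2 by simp
      \<comment> \<open>The powers of \<open>l\<close> are all the m-th roots of unity in the
        closure, so the prescribed root \<open>\<zeta> m\<close> is among them and lies in
        K.\<close>
      have "\<zeta> m ^ m = 1" using zeta[of m] m2 by (simp add: is_primitive_root_of_unity_def)
      then obtain j where "\<zeta> m = to_ac l ^ j"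
        using root_of_unity_eq_power[of m "to_ac l"] m(1) by (metis primitive_root_to_ac_iff)
      then have "\<zeta> m \<in> range to_ac" by (simp only: power_in_range_to_ac rangeI)
      then show "\<exists>m\<ge>2. m dvd n \<and> \<zeta> m \<in> range to_ac" using m(2) m2 by blast
    next
      assume "n > 1 \<and> (\<exists>m\<ge>2. m dvd n \<and> \<zeta> m \<in> range to_ac)"
      then obtain m l where m: "m \<ge> 2" "m dvd n" "\<zeta> m = to_ac l" by blast
      then have "is_primitive_root_of_unity m (to_ac l)" using zeta[of m] by simp
      then have lm: "is_primitive_root_of_unity m l" by simp
      then have "l ^ n = 1" using m(2) primitive_root_power_eq_1_iff by blast
      moreover have "l \<noteq> 1" using primitive_root_power_eq_1_iff[OF lm, of 1] m(1) by auto
      ultimately show "\<exists>l :: 'k. l ^ n = 1 \<and> l \<noteq> 1" by blast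
    qed
    fix n' assume n': "n > 1 \<and> n' = Max {m. m dvd n \<and> \<zeta> m \<in> range to_ac} \<and> n' \<ge> 2"
    obtain l where l: "to_ac l = \<zeta> n'" "is_primitive_root_of_unity n' l"
      and roots: "\<And>w :: 'k. w ^ n = 1 \<longleftrightarrow> w ^ n' = 1"
      using max_root_of_unity_in_range[OF n0 zeta] n' by metis
    have "l ^ n' = 1" using l(2) by (simp add: is_primitive_root_of_unity_def)
    then have l_pow: "(l ^ j) ^ n' = 1" for j by (metis power_mult mult.commute power_one)
    have pow: "{w. w ^ n' = 1} = {l ^ j | j. j \<le> n' - 1}"
    proof (intro equalityI subsetI)
      fix w :: 'k assume "w \<in> {w. w ^ n' = 1}"
      then obtain j where "j < n'" "w = l ^ j"
        using root_of_unity_eq_power[OF l(2)] by blast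
      moreover from \<open>j < n'\<close> have "j \<le> n' - 1" by simp
      ultimately show "w \<in> {l ^ j | j. j \<le> n' - 1}" by blast
    qed (use l_pow in blast)
    have roots_image: "eigengroup f = ?\<sigma> ` {w. w ^ n' = 1}"
      unfolding eg' roots setcompr_eq_image ..
    have powers: "eigengroup f = {(?\<sigma> l) ^^ j | j. j \<le> n' - 1}"
      unfolding roots_image pow subst_aut_fix_funpow setcompr_eq_image image_image ..
    have gen: "?\<sigma> l \<in> eigengroup f"
      unfolding roots_image using \<open>l ^ n' = 1\<close> by (intro imageI) simp
    have generated: "generate (comp_group poly_aut) {?\<sigma> l} = eigengroup f"
      by (rule generate_comp_group_singleton[OF group_poly_aut subgroup_eigengroup powers gen])
    have car: "carrier (comp_group (eigengroup f)) = eigengroup f" by (simp add: comp_group_def)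
    \<comment> \<open>\<open>cyclic_group\<close> asks for generation within the group itself, so
      the argument is repeated with the eigengroup as ambient group.\<close>
    have "subgroup (eigengroup f) (comp_group (eigengroup f))"
      using group.subgroup_self[OF group_eigengroup[of f]] unfolding car .
    then have "generate (comp_group (eigengroup f)) {?\<sigma> l} = eigengroup f"
      by (rule generate_comp_group_singleton[OF group_eigengroup _ powers gen])
    then have "subgroup_generated (comp_group (eigengroup f)) {?\<sigma> l} = comp_group (eigengroup f)"
      using gen by (simp add: subgroup_generated_def comp_group_def)
    then have cyclic: "cyclic_group (comp_group (eigengroup f))"
      unfolding cyclic_group_def car using gen by blast
    \<comment> \<open>Subtraction is truncated at 0; the two index sets agree because
      \<open>n'\<close> is positive.\<close>
    have "{j. j \<le> n' - 1} = {..<n'}" using n' by auto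
    then have "eigengroup f = (\<lambda>j. ?\<sigma> (l ^ j)) ` {..<n'}"
      unfolding powers subst_aut_fix_funpow setcompr_eq_image by simp
    moreover have "inj_on (\<lambda>j. ?\<sigma> (l ^ j)) {..<n'}"
      using primitive_root_inj_on[OF l(2)] by (auto simp: inj_on_def subst_aut_eq_iff)
    ultimately have "Coset.order (comp_group (eigengroup f)) = n'"
      unfolding Coset.order_def car by (simp add: card_image)
    then show "\<exists>l. to_ac l = \<zeta> n' \<and>
             eigengroup f = generate (comp_group poly_aut) {?\<sigma> l} \<and>
             eigengroup f = {(?\<sigma> l) ^^ j | j. j \<le> n' - 1} \<and>
             cyclic_group (comp_group (eigengroup f)) \<and>
             Coset.order (comp_group (eigengroup f)) = n'"
      using l(1) generated powers cyclic by blast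
  qed
  show ?thesis using \<nu> g inter restr single multiple by blast
qed

end
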